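(* Let $(T,M,\mu)$, the rearrangement invariant space $L$ with associate space $L'$, the set $S$ of extremal points, the random field $\xi=\{\xi(t)\}_{t\in T}$, the function $\psi$ and the natural distance $d_\psi(t,s)=\|\xi(t)-\xi(s)\|G\psi$ on $T$ be as in the context. In particular, suppose that $\sup_{t\in T}\|\xi(t)\|G\psi=1$, that for every non-random $g\in L'$ the integral $l_\xi(g)=\int_T\xi(t)g(t)\,\mu(dt)$ exists with probability one, that $\|g\|_{L_1(T,\mu)}\le C_1<\infty$ for all $g\in S$ with a constant $C_1$, and that $$D:=\sup_{g_1,g_2\in S}\rho(g_1,g_2)<\infty,\qquad \rho(g_1,g_2):=\|g_1-g_2\|_{L_1(T,\mu)} .$$ Let $v(y)=\ln\psi(1/y)$ and $v_*(x)=\inf_{y\ge0}(xy+v(y))$. Suppose in addition that $$I:=\int_0^D\exp\left(v_*\left(2+\ln N(T,d_\psi,\epsilon)\right)\right)d\epsilon<\infty .$$ Then $\mathbf{P}(\xi(\cdot)\in L)=1$.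
   Context: $(T,M,\mu)$ is a measure space with $\sigma$-finite separable measure $\mu$ (separable with respect to the distance $(A_1,A_2)\mapsto\mu(A_1\Delta A_2)$). $(L,\|\cdot\|L)$ is a rearrangement invariant Banach function space over $(T,M,\mu)$ in the sense of Bennett and Sharpley; $L$ is not assumed separable. $\xi(t)=\xi(t,\omega)$, $t\in T$, is a separable measurable numerical-valued (real or complex) random field on a probability space $(\Omega,B,\mathbf{P})$ with expectation $\mathbf{E}$. Grand Lebesgue spaces: for a random variable $\eta$ put $|\eta|_p=(\mathbf{E}|\eta|^p)^{1/p}$. For a continuous positive function $\psi$ on an open interval $(a,b)$, $1\le a<b\le\infty$, with $\inf_{p\in(a,b)}\psi(p)>0$ (the support of $\psi$ is $(a,b)$), put $\|\eta\|G\psi=\sup_{p\in(a,b)}|\eta|_p/\psi(p)$. Here $\psi$ has support $(1,b)$ with $1<b\le\infty$, and it is the natural function $\psi_0(p)=\sup_{t\in T}|\xi(t)|_p$ (assumed finite on $(1,b)$) or a majorant of it with the same support, normalized so that $\sup_{t\in T}\|\xi(t)\|G\psi=1$. The natural (semi-)distance on $T$ is $d_\psi(t,s)=\|\xi(t)-\xi(s)\|G\psi$. In the definition of $v_*$, $v(y)$ is understood as $+\infty$ when $1/y$ is outside the support of $\psi$. Associate space: $L'$ is the space of measurable $g$ defining bounded functionals $l_g(f)=\int_T f(t)g(t)\,\mu(dt)$ on $L$, with norm $\|g\|L'=\sup\{l_g(f):\ f\in L,\ \|f\|L=1\}$. $S$ denotes the set of all extremal points of the unit ball of $L'$; it is symmetric,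 $S=-S$, $\|g\|L'=1$ for $g\in S$, and it is taken that $\|f\|L=\sup_{g\in S}l_g(f)$ for all $f\in L$. Covering numbers: for a set $X$ with (semi-)distance $r$, $N(X,r,\epsilon)$ is the minimal number of closed $r$-balls of radius $\epsilon$ covering $X$; thus $N(T,d_\psi,\epsilon)$ is the covering number of the parameter set $T$ in the distance $d_\psi$. *)

theory Defs
  imports "HOL-Probability.Probability"
begin

(* The distance \<mu>(A \<Delta> B) is a (finite) semi-metric only on the sets of finite measure;
   as usual, separability refers to these. *)
definition separable_measure :: "'t measure \<Rightarrow> bool" where
  "separable_measure M \<longleftrightarrow>
     (\<exists>\<A>. countable \<A> \<and> \<A> \<subseteq> {A \<in> sets M. emeasure M A < \<infinity>} \<and>
        (\<forall>A\<in>sets M. emeasure M A < \<infinity> \<longrightarrow>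
           (\<forall>e>0. \<exists>B\<in>\<A>. emeasure M (sym_diff A B) < e)))"

(* Bennett and Sharpley, Definition I.1.1.  The functional \<rho> is only meaningful on measurable
   functions with values in [0, \<infinity>]; nothing is required of it elsewhere. *)
locale banach_function_norm = sigma_finite_measure M
  for M :: "'t measure" and \<rho> :: "('t \<Rightarrow> ennreal) \<Rightarrow> ennreal" +
  assumes eq_0_iff: "f \<in> borel_measurable M \<Longrightarrow> \<rho> f = 0 \<longleftrightarrow> (AE x in M. f x = 0)"
    and scale: "f \<in> borel_measurable M \<Longrightarrow> c \<ge> 0 \<Longrightarrow>
      \<rho> (\<lambda>x. ennreal c * f x) = ennreal c * \<rho> f"
    and triangle: "f \<in> borel_measurable M \<Longrightarrow> g \<in> borel_measurable M \<Longrightarrow>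
      \<rho> (\<lambda>x. f x + g x) \<le> \<rho> f + \<rho> g"
    and mono: "f \<in> borel_measurable M \<Longrightarrow> g \<in> borel_measurable M \<Longrightarrow>
      (AE x in M. g x \<le> f x) \<Longrightarrow> \<rho> g \<le> \<rho> f"
    and fatou: "(\<And>n. F n \<in> borel_measurable M) \<Longrightarrow> f \<in> borel_measurable M \<Longrightarrow>
      (AE x in M. incseq (\<lambda>n. F n x) \<and> f x = (SUP n. F n x)) \<Longrightarrow> \<rho> f = (SUP n. \<rho> (F n))"
    and finite_indicator: "E \<in> sets M \<Longrightarrow> emeasure M E < \<infinity> \<Longrightarrow> \<rho> (indicator E) < \<infinity>"
    and local_L1: "E \<in> sets M \<Longrightarrow> emeasure M E < \<infinity> \<Longrightarrow>
      \<exists>C>0. \<forall>f\<in>borel_measurable M. (\<integral>\<^sup>+x\<in>E. f x \<partial>M) \<le> ennreal C * \<rho> f"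

definition equimeasurable :: "'t measure \<Rightarrow> ('t \<Rightarrow> ennreal) \<Rightarrow> ('t \<Rightarrow> ennreal) \<Rightarrow> bool" where
  "equimeasurable M f g \<longleftrightarrow>
     (\<forall>l\<ge>0. emeasure M {x \<in> space M. f x > ennreal l} = emeasure M {x \<in> space M. g x > ennreal l})"

(* Bennett and Sharpley, Definition II.1.2: \<rho> agrees on equimeasurable a.e. finite functions. *)
locale ri_function_norm = banach_function_norm M \<rho>
  for M :: "'t measure" and \<rho> :: "('t \<Rightarrow> ennreal) \<Rightarrow> ennreal" +
  assumes rearrangement_invariant:
    "f \<in> borel_measurable M \<Longrightarrow> g \<in> borel_measurable M \<Longrightarrow>
     (AE x in M. f x < \<infinity>) \<Longrightarrow> (AE x in M. g x < \<infinity>) \<Longrightarrow>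
     equimeasurable M f g \<Longrightarrow> \<rho> f = \<rho> g"

(* Scalars: a type of sort {real_normed_field, euclidean_space} is the field of real or of complex
   numbers, so both cases are treated at once.  The elements of the spaces L and L' are functions;
   functions that agree almost everywhere represent the same vector. *)

definition bfs :: "'t measure \<Rightarrow> (('t \<Rightarrow> ennreal) \<Rightarrow> ennreal)
    \<Rightarrow> ('t \<Rightarrow> 'k::{real_normed_field, euclidean_space}) set" where
  "bfs M \<rho> = {f \<in> borel_measurable M. \<rho> (\<lambda>x. ennreal (norm (f x))) < \<infinity>}"

definition bfs_norm :: "(('t \<Rightarrow> ennreal) \<Rightarrow> ennreal)
    \<Rightarrow> ('t \<Rightarrow> 'k::{real_normed_field, euclidean_space}) \<Rightarrow> real" where
  "bfs_norm \<rho> f = enn2real (\<rho> (\<lambda>x. ennreal (norm (f x))))"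

definition pairing :: "'t measure \<Rightarrow> ('t \<Rightarrow> 'k::{real_normed_field, euclidean_space})
    \<Rightarrow> ('t \<Rightarrow> 'k) \<Rightarrow> 'k" where
  "pairing M g f = (\<integral>t. f t * g t \<partial>M)"

(* The inner product with 1 is the identity on the reals and the real part on the complex numbers. *)
definition real_part :: "'k::{real_normed_field, euclidean_space} \<Rightarrow> real" where
  "real_part z = inner z 1"

definition associate_space :: "'t measure \<Rightarrow> (('t \<Rightarrow> ennreal) \<Rightarrow> ennreal)
    \<Rightarrow> ('t \<Rightarrow> 'k::{real_normed_field, euclidean_space}) set" where
  "associate_space M \<rho> = {g \<in> borel_measurable M.
     (\<forall>f\<in>bfs M \<rho>. integrable M (\<lambda>t. f t * g t)) \<and>
     (\<exists>C. \<forall>f\<in>bfs M \<rho>. norm (pairing M g f) \<le> C * bfs_norm \<rho> f)}"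

definition associate_norm :: "'t measure \<Rightarrow> (('t \<Rightarrow> ennreal) \<Rightarrow> ennreal)
    \<Rightarrow> ('t \<Rightarrow> 'k::{real_normed_field, euclidean_space}) \<Rightarrow> ereal" where
  "associate_norm M \<rho> g =
     (SUP f\<in>{f \<in> bfs M \<rho>. bfs_norm \<rho> f = 1}. ereal (real_part (pairing M g f)))"

definition associate_ball :: "'t measure \<Rightarrow> (('t \<Rightarrow> ennreal) \<Rightarrow> ennreal)
    \<Rightarrow> ('t \<Rightarrow> 'k::{real_normed_field, euclidean_space}) set" where
  "associate_ball M \<rho> = {g \<in> associate_space M \<rho>. associate_norm M \<rho> g \<le> 1}"

(* Extremality for vectors that are classes modulo a.e. equality; the set contains every
   representative of each extremal class. *)
definition extremal_points :: "'t measure \<Rightarrow> (('t \<Rightarrow> ennreal) \<Rightarrow> ennreal)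
    \<Rightarrow> ('t \<Rightarrow> 'k::{real_normed_field, euclidean_space}) set" where
  "extremal_points M \<rho> = {g \<in> associate_ball M \<rho>.
     \<forall>g1\<in>associate_ball M \<rho>. \<forall>g2\<in>associate_ball M \<rho>. \<forall>u::real. 0 < u \<and> u < 1 \<and>
       (AE t in M. g t = (1 - u) *\<^sub>R g1 t + u *\<^sub>R g2 t) \<longrightarrow> (AE t in M. g1 t = g2 t)}"

definition L1_norm :: "'t measure \<Rightarrow> ('t \<Rightarrow> 'k::real_normed_vector) \<Rightarrow> ennreal" where
  "L1_norm M g = (\<integral>\<^sup>+t. ennreal (norm (g t)) \<partial>M)"

definition moment_norm :: "'w measure \<Rightarrow> real \<Rightarrow> ('w \<Rightarrow> 'k::real_normed_vector) \<Rightarrow> ennreal" where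
  "moment_norm P p \<eta> =
     (let m = (\<integral>\<^sup>+\<omega>. ennreal (norm (\<eta> \<omega>) powr p) \<partial>P)
      in if m = \<infinity> then \<infinity> else ennreal (enn2real m powr (1 / p)))"

(* The open interval einterval a b is the support of psi. *)
definition psi_function :: "ereal \<Rightarrow> ereal \<Rightarrow> (real \<Rightarrow> real) \<Rightarrow> bool" where
  "psi_function a b \<psi> \<longleftrightarrow> 1 \<le> a \<and> a < b \<and> continuous_on (einterval a b) \<psi> \<and>
     (\<forall>p\<in>einterval a b. \<psi> p > 0) \<and> (INF p\<in>einterval a b. \<psi> p) > 0"

definition gpsi_norm :: "'w measure \<Rightarrow> ereal \<Rightarrow> ereal \<Rightarrow> (real \<Rightarrow> real)
    \<Rightarrow> ('w \<Rightarrow> 'k::real_normed_vector) \<Rightarrow> ennreal" where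
  "gpsi_norm P a b \<psi> \<eta> = (SUP p\<in>einterval a b. moment_norm P p \<eta> / ennreal (\<psi> p))"

definition natural_function :: "'t set \<Rightarrow> 'w measure \<Rightarrow> ('t \<Rightarrow> 'w \<Rightarrow> 'k::real_normed_vector)
    \<Rightarrow> real \<Rightarrow> ennreal" where
  "natural_function T P \<xi> p = (SUP t\<in>T. moment_norm P p (\<xi> t))"

definition natural_dist :: "'w measure \<Rightarrow> ereal \<Rightarrow> ereal \<Rightarrow> (real \<Rightarrow> real)
    \<Rightarrow> ('t \<Rightarrow> 'w \<Rightarrow> 'k::real_normed_vector) \<Rightarrow> 't \<Rightarrow> 't \<Rightarrow> ennreal" where
  "natural_dist P a b \<psi> \<xi> t s = gpsi_norm P a b \<psi> (\<lambda>\<omega>. \<xi> t \<omega> - \<xi> s \<omega>)"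

definition dist_open :: "'t set \<Rightarrow> ('t \<Rightarrow> 't \<Rightarrow> ennreal) \<Rightarrow> 't set \<Rightarrow> bool" where
  "dist_open T r G \<longleftrightarrow> G \<subseteq> T \<and> (\<forall>t\<in>G. \<exists>e>0. \<forall>s\<in>T. r t s < e \<longrightarrow> s \<in> G)"

(* Doob separability of a field on T with respect to the semi-distance r.  The exceptional null
   set does not depend on G and F. *)
definition separable_field :: "'t set \<Rightarrow> ('t \<Rightarrow> 't \<Rightarrow> ennreal) \<Rightarrow> 'w measure
    \<Rightarrow> ('t \<Rightarrow> 'w \<Rightarrow> 'k::topological_space) \<Rightarrow> bool" where
  "separable_field T r P \<xi> \<longleftrightarrow>
     (\<exists>Q. countable Q \<and> Q \<subseteq> T \<and> (\<forall>t\<in>T. \<forall>e>0. \<exists>q\<in>Q. r t q < e) \<and>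
        (AE \<omega> in P. \<forall>G F. dist_open T r G \<and> closed F \<and> (\<forall>t\<in>G \<inter> Q. \<xi> t \<omega> \<in> F) \<longrightarrow>
           (\<forall>t\<in>G. \<xi> t \<omega> \<in> F)))"

(* The infimum of the empty set is \<infinity>. *)
definition covering_number :: "'t set \<Rightarrow> ('t \<Rightarrow> 't \<Rightarrow> ennreal) \<Rightarrow> real \<Rightarrow> enat" where
  "covering_number X r e =
     Inf {enat (card F) | F. finite F \<and> F \<subseteq> X \<and> X \<subseteq> (\<Union>x\<in>F. {y \<in> X. r x y \<le> ennreal e})}"

definition ln_ereal :: "ereal \<Rightarrow> ereal" where
  "ln_ereal x =
     (if x = \<infinity> then \<infinity> else if x \<le> 0 then -\<infinity> else ereal (ln (real_of_ereal x)))"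

definition exp_ereal :: "ereal \<Rightarrow> ennreal" where
  "exp_ereal x =
     (if x = \<infinity> then \<infinity> else if x = -\<infinity> then 0 else ennreal (exp (real_of_ereal x)))"

(* At y = 0, where 1 / y stands for \<infinity>, the value is \<infinity> as well: the HOL convention 1 / 0 = 0
   also gives a point outside einterval a b, because a \<ge> 1. *)
definition v_fun :: "ereal \<Rightarrow> ereal \<Rightarrow> (real \<Rightarrow> real) \<Rightarrow> real \<Rightarrow> ereal" where
  "v_fun a b \<psi> y = (if 1 / y \<in> einterval a b then ereal (ln (\<psi> (1 / y))) else \<infinity>)"

definition v_star :: "ereal \<Rightarrow> ereal \<Rightarrow> (real \<Rightarrow> real) \<Rightarrow> ereal \<Rightarrow> ereal" where
  "v_star a b \<psi> x = (INF y\<in>{0..}. x * ereal y + v_fun a b \<psi> y)"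

end

theory Submission
  imports Defs
begin

text \<open>
  The membership \<open>\<xi>(\<cdot>, \<omega>) \<in> L\<close> follows from the almost sure boundedness of the field on \<open>T\<close>,
  and boundedness follows from the entropy integral by chaining on \<open>T\<close>.

  From bounded to \<open>L\<close>: since the functionals in \<open>S\<close> are norming and lie in a fixed ball of
  \<open>L\<^sub>1\<close>, a function \<open>f\<close> bounded by \<open>R\<close> and supported on a set of finite measure has norm at most
  \<open>R C\<^sub>1\<close>. This estimate does not see the support, and the Fatou property of the norm carries it
  over to an arbitrary bounded \<open>f\<close> (\<open>bfs_if_bounded\<close>).

  From entropy to boundedness: unravelling the definition of \<open>v\<^sub>*\<close>,
  \<open>exp (v\<^sub>* (2 + ln N)) = inf\<^sub>p e\<^bsup>2/p\<^esup> N\<^bsup>1/p\<^esup> \<psi>(p)\<close>, and \<open>N\<^bsup>1/p\<^esup> \<psi>(p)\<close> is, up to a factor, the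
  bound that the \<open>p\<close>-th moments give for the expected maximum of \<open>N\<close> variables in the unit ball of
  \<open>G\<psi>\<close> (\<open>nn_integral_SUP_le_exp_v_star\<close>). Nets of radius \<open>\<epsilon>\<^sub>k = D 2\<^bsup>-k-1\<^esup>\<close> in \<open>T\<close>, joined by
  links of \<open>d\<close>-length at most \<open>\<epsilon>\<^sub>k\<close>, therefore have total expected fluctuation at most a
  multiple of the sum of \<open>\<epsilon>\<^sub>k exp (v\<^sub>* (2 + ln N(\<epsilon>\<^sub>k\<^sub>+\<^sub>1)))\<close>, which is dominated by the
  entropy integral (\<open>dyadic_sum_le_integral\<close>). This bounds the field on the union of the nets,
  hence on any countable set of parameters and, by separability, on \<open>T\<close>.

  The coarsest net needs a radius below the upper limit \<open>D\<close> of the integral, so the chaining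
  requires \<open>D > 0\<close>. If \<open>D = 0\<close>, the set \<open>S\<close> is a single class modulo null sets; applied to
  \<open>f\<close> and to \<open>-f\<close>, the norming property then forces \<open>\<parallel>f\<parallel> = 0\<close>, so that \<open>\<mu>\<close> vanishes and the
  claim is trivial (\<open>null_measure_if_single_norming\<close>).
\<close>

section \<open>The entropy function\<close>

lemma exp_ereal_mono: "x \<le> y \<Longrightarrow> exp_ereal x \<le> exp_ereal y"
  by (cases x; cases y) (auto simp: exp_ereal_def intro: ennreal_leI)

lemma ln_ereal_mono: "x \<le> y \<Longrightarrow> ln_ereal x \<le> ln_ereal y"
  by (cases x; cases y) (auto simp: ln_ereal_def)

lemma v_star_mono: "x \<le> x' \<Longrightarrow> v_star a b \<psi> x \<le> v_star a b \<psi> x'"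
  unfolding v_star_def
  by (intro INF_superset_mono add_right_mono ereal_mult_right_mono) auto

lemma v_star_PInfty: "v_star 1 b \<psi> \<infinity> = \<infinity>"
proof -
  have "\<infinity> * ereal y + v_fun 1 b \<psi> y = \<infinity>" if "y \<ge> 0" for y
  proof (cases "y = 0")
    case True
    then show ?thesis by (simp add: v_fun_def einterval_def)
  next
    case False
    with that show ?thesis by (auto simp: v_fun_def)
  qed
  then have "v_star 1 b \<psi> \<infinity> = (INF y\<in>{0::real..}. \<infinity>)"
    unfolding v_star_def by (intro INF_cong) auto
  then show ?thesis
    by simp
qed

text \<open>
  The substitution \<open>y = 1/p\<close> turns the infimum that defines \<open>v\<^sub>*\<close> into an infimum over the moments
  \<open>p\<close>; this is the direction of the resulting formula for \<open>exp (v\<^sub>* r)\<close> that estimates need.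
\<close>

lemma le_exp_v_star:
  assumes b: "1 < b"
    and pos: "\<And>p. p \<in> einterval 1 b \<Longrightarrow> \<psi> p > 0"
    and le: "\<And>p. p \<in> einterval 1 b \<Longrightarrow> A \<le> ennreal (exp (r / p) * \<psi> p)"
  shows "A \<le> exp_ereal (v_star 1 b \<psi> (ereal r))"
proof (cases "A = 0")
  case False
  obtain p0 where p0: "p0 \<in> einterval 1 b"
    using einterval_nonempty[OF b] by blast
  have "A < \<infinity>"
    using le[OF p0] by (auto simp: less_top[symmetric] top_unique)
  with False obtain a where a: "A = ennreal a" "a > 0"
    by (cases A) (auto simp: less_le)
  have "ereal (ln a) \<le> v_star 1 b \<psi> (ereal r)"
    unfolding v_star_def
  proof (rule INF_greatest)
    fix y :: real
    assume "y \<in> {0..}"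
    show "ereal (ln a) \<le> ereal r * ereal y + v_fun 1 b \<psi> y"
    proof (cases "1 / y \<in> einterval 1 b")
      case True
      have "a \<le> exp (r * y) * \<psi> (1 / y)"
        using le[OF True] pos[OF True] a by (simp add: ennreal_le_iff)
      then have "ln a \<le> ln (exp (r * y) * \<psi> (1 / y))"
        using a by simp
      also have "\<dots> = r * y + ln (\<psi> (1 / y))"
        using pos[OF True] by (simp add: ln_mult)
      finally show ?thesis
        using True by (simp add: v_fun_def)
    qed (simp add: v_fun_def)
  qed
  from exp_ereal_mono[OF this] a show ?thesis
    by (simp add: exp_ereal_def)
qed simp

section \<open>Maximal inequalities\<close>

text \<open>
  Split at the level \<open>l = N\<^bsup>1/p\<^esup> c\<close>: a variable \<open>X\<close> above that level satisfies
  \<open>|X| \<le> |X|\<^sup>p l\<^bsup>1-p\<^esup>\<close>, and by the choice of \<open>l\<close> the sum of the \<open>N\<close> expectations of the right side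
  is at most \<open>l\<close>. This costs a factor \<open>2\<close> against the bound given by Jensen's inequality.
\<close>

lemma nn_integral_SUP_le_moments:
  fixes X :: "'i \<Rightarrow> 'w \<Rightarrow> 'k::{real_normed_vector, second_countable_topology}"
  assumes P: "prob_space P" and p: "p \<ge> 1" and c: "c > 0"
    and F: "finite F" "F \<noteq> {}"
    and X: "\<And>t. t \<in> F \<Longrightarrow> X t \<in> borel_measurable P"
    and moment: "\<And>t. t \<in> F \<Longrightarrow> moment_norm P p (X t) \<le> ennreal c"
  shows "(\<integral>\<^sup>+\<omega>. (SUP t\<in>F. ennreal (norm (X t \<omega>))) \<partial>P) \<le> ennreal (2 * (real (card F) powr (1 / p) * c))"
proof -
  interpret prob_space P by (rule P)
  define l where "l = real (card F) powr (1 / p) * c"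
  have card: "card F > 0"
    using F by (simp add: card_gt_0_iff)
  have l: "l > 0"
    using card c by (simp add: l_def)
  have int_le: "(\<integral>\<^sup>+\<omega>. ennreal (norm (X t \<omega>) powr p) \<partial>P) \<le> ennreal (c powr p)" if "t \<in> F" for t
  proof -
    let ?m = "\<integral>\<^sup>+\<omega>. ennreal (norm (X t \<omega>) powr p) \<partial>P"
    have fin: "?m < \<infinity>"
      using moment[OF that] by (auto simp: moment_norm_def Let_def top_unique less_top split: if_splits)
    then have le: "enn2real ?m powr (1 / p) \<le> c"
      using moment[OF that] c by (simp add: moment_norm_def Let_def ennreal_le_iff less_top[symmetric] split: if_splits)
    have "enn2real ?m = (enn2real ?m powr (1 / p)) powr p"
      using p by (simp add: powr_powr)
    also have "\<dots> \<le> c powr p"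
      using le p by (intro powr_mono2) auto
    finally have "ennreal (enn2real ?m) \<le> ennreal (c powr p)"
      by (rule ennreal_leI)
    then show ?thesis
      using fin by (simp only: ennreal_enn2real infinity_ennreal_def)
  qed
  have pointwise: "(SUP t\<in>F. ennreal (norm (X t \<omega>)))
      \<le> ennreal l + (\<Sum>t\<in>F. ennreal (l powr (1 - p)) * ennreal (norm (X t \<omega>) powr p))" for \<omega>
  proof (rule SUP_least)
    fix t assume t: "t \<in> F"
    let ?x = "norm (X t \<omega>)"
    have "?x \<le> l + l powr (1 - p) * ?x powr p"
    proof (cases "?x \<le> l")
      case False
      then have "?x = ?x powr (1 - p) * ?x powr p"
        using l by (simp add: powr_add[symmetric])
      also have "\<dots> \<le> l powr (1 - p) * ?x powr p"
        using False l p by (intro mult_right_mono powr_mono2') auto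
      finally show ?thesis using l by simp
    qed (auto intro: add_increasing2)
    then have "ennreal ?x \<le> ennreal l + ennreal (l powr (1 - p)) * ennreal (?x powr p)"
      using l by (simp add: ennreal_mult[symmetric] ennreal_plus[symmetric] ennreal_leI del: ennreal_plus)
    also have "ennreal (l powr (1 - p)) * ennreal (?x powr p)
        \<le> (\<Sum>t\<in>F. ennreal (l powr (1 - p)) * ennreal (norm (X t \<omega>) powr p))"
      using t F by (intro member_le_sum[where f = "\<lambda>t. ennreal (l powr (1 - p)) * ennreal (norm (X t \<omega>) powr p)"]) auto
    finally show "ennreal ?x \<le> ennreal l + (\<Sum>t\<in>F. ennreal (l powr (1 - p)) * ennreal (norm (X t \<omega>) powr p))"
      by (simp add: add_left_mono)
  qed
  have [measurable]: "(\<lambda>\<omega>. norm (X t \<omega>) powr p) \<in> borel_measurable P" if "t \<in> F" for t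
    using X[OF that] by measurable
  have "(\<integral>\<^sup>+\<omega>. (SUP t\<in>F. ennreal (norm (X t \<omega>))) \<partial>P)
      \<le> (\<integral>\<^sup>+\<omega>. ennreal l + (\<Sum>t\<in>F. ennreal (l powr (1 - p)) * ennreal (norm (X t \<omega>) powr p)) \<partial>P)"
    by (intro nn_integral_mono pointwise)
  also have "\<dots> = ennreal l + (\<Sum>t\<in>F. ennreal (l powr (1 - p)) * (\<integral>\<^sup>+\<omega>. ennreal (norm (X t \<omega>) powr p) \<partial>P))"
    by (subst nn_integral_add) (auto simp: nn_integral_sum nn_integral_cmult emeasure_space_1)
  also have "\<dots> \<le> ennreal l + (\<Sum>t\<in>F. ennreal (l powr (1 - p)) * ennreal (c powr p))"
    by (intro add_left_mono sum_mono mult_left_mono int_le) auto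
  also have "\<dots> = ennreal (l + real (card F) * (l powr (1 - p) * c powr p))"
    using l by (simp add: ennreal_mult[symmetric] ennreal_of_nat_eq_real_of_nat)
  also have "real (card F) * (l powr (1 - p) * c powr p) = l"
  proof -
    have "l powr p = real (card F) * c powr p"
      using card c p by (simp add: l_def powr_mult powr_powr)
    then have "real (card F) * (l powr (1 - p) * c powr p) = l powr (1 - p) * l powr p"
      by simp
    also have "\<dots> = l"
      using l by (simp add: powr_add[symmetric])
    finally show ?thesis .
  qed
  also have "l + l = 2 * (real (card F) powr (1 / p) * c)"
    by (simp add: l_def)
  finally show ?thesis .
qed

lemma moment_norm_le_gpsi_norm:
  assumes p: "p \<in> einterval a b" and pos: "\<psi> p > 0" and e: "e \<ge> 0"
    and le: "gpsi_norm P a b \<psi> X \<le> ennreal e"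
  shows "moment_norm P p X \<le> ennreal (e * \<psi> p)"
proof -
  have "moment_norm P p X / ennreal (\<psi> p) \<le> gpsi_norm P a b \<psi> X"
    unfolding gpsi_norm_def using p by (rule SUP_upper)
  also note le
  finally have "moment_norm P p X / ennreal (\<psi> p) * ennreal (\<psi> p) \<le> ennreal e * ennreal (\<psi> p)"
    by (rule mult_right_mono) simp
  then show ?thesis
    using pos e by (simp add: ennreal_divide_times ennreal_mult[symmetric] divide_mult_eq)
qed

text \<open>
  The previous inequality is available for each \<open>p\<close> in the support of \<open>\<psi>\<close>; optimizing over \<open>p\<close>
  produces \<open>v\<^sub>*\<close>.
\<close>

lemma nn_integral_SUP_le_exp_v_star:
  fixes X :: "'i \<Rightarrow> 'w \<Rightarrow> 'k::{real_normed_vector, second_countable_topology}"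
  assumes P: "prob_space P" and psi: "psi_function 1 b \<psi>" and e: "e > 0"
    and F: "finite F" "F \<noteq> {}"
    and X: "\<And>t. t \<in> F \<Longrightarrow> X t \<in> borel_measurable P"
    and le: "\<And>t. t \<in> F \<Longrightarrow> gpsi_norm P 1 b \<psi> (X t) \<le> ennreal e"
  shows "(\<integral>\<^sup>+\<omega>. (SUP t\<in>F. ennreal (norm (X t \<omega>))) \<partial>P)
    \<le> ennreal (2 * e) * exp_ereal (v_star 1 b \<psi> (2 + ln_ereal (ereal_of_enat (enat (card F)))))"
    (is "?A \<le> _")
proof -
  have b: "1 < b" and pos: "\<And>p. p \<in> einterval 1 b \<Longrightarrow> \<psi> p > 0"
    using psi by (auto simp: psi_function_def)
  have card: "card F > 0"
    using F by (simp add: card_gt_0_iff)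
  define r where "r = 2 + ln (real (card F))"
  have "?A / ennreal (2 * e) \<le> exp_ereal (v_star 1 b \<psi> (ereal r))"
  proof (rule le_exp_v_star[OF b pos])
    fix p assume p: "p \<in> einterval 1 b"
    then have p1: "p > 1" by (simp add: einterval_def)
    have "?A \<le> ennreal (2 * (real (card F) powr (1 / p) * (e * \<psi> p)))"
      using p1 e pos[OF p] F X moment_norm_le_gpsi_norm[where \<psi> = \<psi>, OF p pos[OF p] less_imp_le[OF e] le]
      by (intro nn_integral_SUP_le_moments[OF P]) auto
    (* The summand 2 of r only enlarges the bound: exp (2 / p) \<ge> 1. *)
    also have "\<dots> \<le> ennreal (2 * (exp (r / p) * (e * \<psi> p)))"
    proof -
      have "real (card F) powr (1 / p) = exp (ln (real (card F)) / p)"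
        using card by (simp add: powr_def)
      also have "\<dots> \<le> exp (r / p)"
        using p1 by (simp add: r_def divide_right_mono)
      finally show ?thesis
        using e pos[OF p] by (intro ennreal_leI mult_left_mono mult_right_mono) auto
    qed
    also have "\<dots> = ennreal (exp (r / p) * \<psi> p) * ennreal (2 * e)"
      using e pos[OF p] by (simp add: ennreal_mult[symmetric] mult_ac)
    finally have "?A / ennreal (2 * e) \<le> ennreal (exp (r / p) * \<psi> p) * ennreal (2 * e) / ennreal (2 * e)"
      by (rule divide_right_mono_ennreal)
    also have "\<dots> = ennreal (exp (r / p) * \<psi> p)"
      using e by (simp add: ennreal_mult_divide_eq)
    finally show "?A / ennreal (2 * e) \<le> ennreal (exp (r / p) * \<psi> p)" .
  qed
  then have "?A / ennreal (2 * e) * ennreal (2 * e)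
      \<le> exp_ereal (v_star 1 b \<psi> (ereal r)) * ennreal (2 * e)"
    by (rule mult_right_mono) simp
  moreover have "2 + ln_ereal (ereal_of_enat (enat (card F))) = ereal r"
    using card by (simp add: ln_ereal_def r_def)
  moreover have "?A / ennreal (2 * e) * ennreal (2 * e) = ?A"
    using e by (simp add: ennreal_divide_times ennreal_divide_self)
  ultimately show ?thesis
    by (simp only: mult.commute)
qed

section \<open>Covering numbers and the entropy integral\<close>

lemma covering_number_antimono:
  assumes "e \<le> e'"
  shows "covering_number X r e' \<le> covering_number X r e"
  unfolding covering_number_def
proof (rule Inf_superset_mono, safe)
  fix F assume F: "finite F" "F \<subseteq> X" "X \<subseteq> (\<Union>x\<in>F. {y \<in> X. r x y \<le> ennreal e})"
  have "{y \<in> X. r x y \<le> ennreal e} \<subseteq> {y \<in> X. r x y \<le> ennreal e'}" for x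
    using order_trans[OF _ ennreal_leI[OF assms]] by blast
  then have "X \<subseteq> (\<Union>x\<in>F. {y \<in> X. r x y \<le> ennreal e'})"
    by (intro order_trans[OF F(3)] UN_mono) auto
  with F(1,2) show "\<exists>Fa. enat (card F) = enat (card Fa) \<and> finite Fa \<and> Fa \<subseteq> X \<and>
      X \<subseteq> (\<Union>x\<in>Fa. {y \<in> X. r x y \<le> ennreal e'})"
    by (intro exI[of _ F] conjI) auto
qed

lemma covering_number_attained:
  assumes "covering_number X r e \<noteq> \<infinity>"
  obtains F where "finite F" "F \<subseteq> X" "\<And>y. y \<in> X \<Longrightarrow> \<exists>x\<in>F. r x y \<le> ennreal e"
    "covering_number X r e = enat (card F)"
proof -
  let ?C = "{enat (card F) | F. finite F \<and> F \<subseteq> X \<and> X \<subseteq> (\<Union>x\<in>F. {y \<in> X. r x y \<le> ennreal e})}"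
  have "?C \<noteq> {}"
    using assms unfolding covering_number_def by (metis Inf_empty top_enat_def)
  then have "covering_number X r e \<in> ?C"
    unfolding covering_number_def by (meson ex_in_conv wellorder_InfI)
  then obtain F where F: "covering_number X r e = enat (card F)" "finite F" "F \<subseteq> X"
      "X \<subseteq> (\<Union>x\<in>F. {y \<in> X. r x y \<le> ennreal e})"
    unfolding mem_Collect_eq by (elim exE conjE)
  have "\<exists>x\<in>F. r x y \<le> ennreal e" if "y \<in> X" for y
    using subsetD[OF F(4) that] by simp
  from that[OF F(2,3) this F(1)] show thesis .
qed

lemma entropy_integrand_antimono:
  assumes "e \<le> e'"
  shows "exp_ereal (v_star 1 b \<psi> (2 + ln_ereal (ereal_of_enat (covering_number X r e'))))
    \<le> exp_ereal (v_star 1 b \<psi> (2 + ln_ereal (ereal_of_enat (covering_number X r e))))"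
  by (intro exp_ereal_mono v_star_mono add_left_mono ln_ereal_mono)
    (simp add: covering_number_antimono[OF assms])

text \<open>
  Where \<open>N = \<infinity>\<close> the integrand is \<open>\<infinity>\<close>, and by monotonicity it would then be \<open>\<infinity>\<close> all the way
  down to \<open>0\<close>.
\<close>

lemma covering_number_finite:
  assumes I: "(\<integral>\<^sup>+\<epsilon>\<in>{0<..<D}. exp_ereal (v_star 1 b \<psi>
      (2 + ln_ereal (ereal_of_enat (covering_number X r \<epsilon>)))) \<partial>lborel) < \<infinity>"
    and e: "0 < e" "e < D"
  shows "covering_number X r e \<noteq> \<infinity>"
proof
  assume N: "covering_number X r e = \<infinity>"
  define h where "h \<epsilon> = exp_ereal (v_star 1 b \<psi> (2 + ln_ereal (ereal_of_enat (covering_number X r \<epsilon>))))" for \<epsilon>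
  have "h e = \<infinity>"
    by (simp add: h_def N ln_ereal_def v_star_PInfty exp_ereal_def)
  then have h_top: "h \<epsilon> = \<infinity>" if "\<epsilon> \<le> e" for \<epsilon>
    using entropy_integrand_antimono[OF that, of b \<psi> X r] unfolding h_def by (simp add: top_unique)
  have "(\<integral>\<^sup>+\<epsilon>. \<infinity> * indicator {0<..e} \<epsilon> \<partial>lborel) \<le> (\<integral>\<^sup>+\<epsilon>\<in>{0<..<D}. h \<epsilon> \<partial>lborel)"
    using e by (intro nn_integral_mono) (auto simp: indicator_def h_top)
  moreover have "(\<integral>\<^sup>+\<epsilon>. \<infinity> * indicator {0<..e} \<epsilon> \<partial>lborel) = (\<infinity>::ennreal)"
    using e by (subst nn_integral_cmult_indicator) (auto simp: ennreal_top_mult)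
  ultimately show False
    using I unfolding h_def by (simp add: top_unique)
qed

text \<open>
  Each term is \<open>4\<close> times the area of a rectangle of height \<open>h(D/2\<^bsup>k+2\<^esup>)\<close> over the interval
  between \<open>D/2\<^bsup>k+3\<^esup>\<close> and \<open>D/2\<^bsup>k+2\<^esup>\<close>; these rectangles lie below the graph of \<open>h\<close>.
\<close>

lemma dyadic_sum_le_integral:
  fixes h :: "real \<Rightarrow> ennreal"
  assumes anti: "\<And>e e'. e \<le> e' \<Longrightarrow> h e' \<le> h e" and D: "D > 0"
  shows "(\<Sum>k. ennreal (D / 2 ^ (k + 1)) * h (D / 2 ^ (k + 2)))
    \<le> 4 * (\<integral>\<^sup>+\<epsilon>\<in>{0<..<D}. h \<epsilon> \<partial>lborel)"
proof -
  define A where "A k = {D / 2 ^ (k + 3) <.. D / 2 ^ (k + 2)}" for k :: nat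
  have le_half: "D / 2 ^ (m + 2) \<le> D / 2 ^ (k + 3)" if "k < m" for k m :: nat
  proof -
    have "(2::real) ^ (k + 3) \<le> 2 ^ (m + 2)"
      using that by (intro power_increasing) auto
    then show ?thesis
      using D by (intro divide_left_mono) auto
  qed
  have disj: "disjoint_family A"
    unfolding disjoint_family_on_def
  proof safe
    fix k m :: nat and x assume "k \<noteq> m" "x \<in> A k" "x \<in> A m"
    then show "x \<in> {}"
      using le_half[of k m] le_half[of m k] by (auto simp: A_def neq_iff)
  qed
  have len: "emeasure lborel (A k) = ennreal (D / 2 ^ (k + 3))" for k
  proof -
    have "D / 2 ^ (k + 2) = 2 * (D / 2 ^ (k + 3))"
      by (simp add: power_add)
    moreover have "D / 2 ^ (k + 3) > 0"
      using D by simp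
    ultimately show ?thesis
      unfolding A_def by (subst emeasure_lborel_Ioc) auto
  qed
  have "(\<Sum>k. ennreal (D / 2 ^ (k + 1)) * h (D / 2 ^ (k + 2)))
      = (\<Sum>k. 4 * (h (D / 2 ^ (k + 2)) * emeasure lborel (A k)))"
  proof (intro arg_cong[where f = suminf] ext)
    fix k
    have "ennreal (D / 2 ^ (k + 1)) = ennreal (4 * (D / 2 ^ (k + 3)))"
      by (simp add: power_add)
    also have "\<dots> = 4 * ennreal (D / 2 ^ (k + 3))"
      using D by (subst ennreal_mult) auto
    finally show "ennreal (D / 2 ^ (k + 1)) * h (D / 2 ^ (k + 2))
        = 4 * (h (D / 2 ^ (k + 2)) * emeasure lborel (A k))"
      by (simp add: len mult_ac)
  qed
  also have "\<dots> = 4 * (\<Sum>k. h (D / 2 ^ (k + 2)) * emeasure lborel (A k))"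
    by simp
  also have "(\<Sum>k. h (D / 2 ^ (k + 2)) * emeasure lborel (A k))
      = (\<integral>\<^sup>+\<epsilon>. (\<Sum>k. h (D / 2 ^ (k + 2)) * indicator (A k) \<epsilon>) \<partial>lborel)"
    by (subst nn_integral_suminf) (auto simp: A_def nn_integral_cmult_indicator)
  also have "\<dots> \<le> (\<integral>\<^sup>+\<epsilon>\<in>{0<..<D}. h \<epsilon> \<partial>lborel)"
  proof (intro nn_integral_mono)
    fix \<epsilon> :: real
    show "(\<Sum>k. h (D / 2 ^ (k + 2)) * indicator (A k) \<epsilon>) \<le> h \<epsilon> * indicator {0<..<D} \<epsilon>"
    proof (cases "\<exists>k. \<epsilon> \<in> A k")
      case True
      then obtain k where k: "\<epsilon> \<in> A k" ..
      have "(1::real) < 2 ^ (k + 2)"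
        by (rule one_less_power) auto
      then have "D / 2 ^ (k + 2) < D"
        using mult_strict_left_mono[OF _ D] by (fastforce simp: pos_divide_less_eq)
      moreover have "0 < D / 2 ^ (k + 3)"
        using D by simp
      ultimately have "\<epsilon> \<in> {0<..<D}"
        using k unfolding A_def by (auto simp del: zero_less_divide_iff)
      moreover have "h (D / 2 ^ (k + 2)) \<le> h \<epsilon>"
        using k by (intro anti) (simp add: A_def)
      ultimately show ?thesis
        unfolding suminf_cmult_indicator[OF disj k] by simp
    qed simp
  qed
  finally show ?thesis
    by (simp add: mult_left_mono)
qed

section \<open>Boundedness of the field by chaining\<close>

text \<open>
  A point of the net \<open>F k\<close> is reached from \<open>F 0\<close> along the chain of its successive parents under
  \<open>\<pi>\<close>, and the \<open>j\<close>-th link of such a chain is at most the largest increment over \<open>F (Suc j)\<close>.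
\<close>

lemma chain_bound:
  fixes x :: "'t \<Rightarrow> 'k::real_normed_vector"
  assumes parent: "\<And>k t. t \<in> F (Suc k) \<Longrightarrow> \<pi> k t \<in> F k" and t: "t \<in> F k"
  shows "ennreal (norm (x t)) \<le> (SUP t\<in>F 0. ennreal (norm (x t)))
    + (\<Sum>j. SUP t\<in>F (Suc j). ennreal (norm (x t - x (\<pi> j t))))"
    (is "_ \<le> ?m + (\<Sum>j. ?Y j)")
proof -
  have "ennreal (norm (x t)) \<le> ?m + (\<Sum>j<k. ?Y j)"
    using t
  proof (induction k arbitrary: t)
    case 0
    then show ?case by (auto intro: SUP_upper)
  next
    case (Suc k)
    have "norm (x t) \<le> norm (x (\<pi> k t)) + norm (x t - x (\<pi> k t))"
      using norm_triangle_ineq[of "x (\<pi> k t)" "x t - x (\<pi> k t)"] by simp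
    then have "ennreal (norm (x t)) \<le> ennreal (norm (x (\<pi> k t))) + ennreal (norm (x t - x (\<pi> k t)))"
      by (simp add: ennreal_plus[symmetric] ennreal_leI del: ennreal_plus)
    also have "\<dots> \<le> (?m + (\<Sum>j<k. ?Y j)) + ?Y k"
      using Suc.IH[OF parent[OF Suc.prems]] Suc.prems by (intro add_mono SUP_upper) auto
    finally show ?case
      by (simp add: add.assoc)
  qed
  also have "\<dots> \<le> ?m + (\<Sum>j. ?Y j)"
    by (intro add_left_mono sum_le_suminf) auto
  finally show ?thesis .
qed

text \<open>
  Along nets of radius \<open>\<epsilon>\<^sub>k = D/2\<^bsup>k+1\<^esup>\<close> the chain bound has finite expectation. A parameter \<open>q\<close>
  outside the nets is approximated by its neighbours in them: the expected distances are summable,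
  so almost surely the approximation converges and the chain bound passes to \<open>q\<close>. The exceptional
  set depends on \<open>q\<close>, which limits the conclusion to countably many parameters.
\<close>

lemma AE_bounded_on_countable:
  fixes \<xi> :: "'t \<Rightarrow> 'w \<Rightarrow> 'k::{real_normed_vector, second_countable_topology}"
  assumes P: "prob_space P" and psi: "psi_function 1 b \<psi>"
    and meas: "\<And>t. t \<in> T \<Longrightarrow> \<xi> t \<in> borel_measurable P"
    and unit: "\<And>t. t \<in> T \<Longrightarrow> gpsi_norm P 1 b \<psi> (\<xi> t) \<le> 1"
    and D: "D > 0"
    and I: "(\<integral>\<^sup>+\<epsilon>\<in>{0<..<D}. exp_ereal (v_star 1 b \<psi>
      (2 + ln_ereal (ereal_of_enat (covering_number T (natural_dist P 1 b \<psi> \<xi>) \<epsilon>)))) \<partial>lborel) < \<infinity>"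
    and Q: "countable Q" "Q \<subseteq> T"
  shows "AE \<omega> in P. \<exists>R. \<forall>q\<in>Q. norm (\<xi> q \<omega>) \<le> R"
proof (cases "T = {}")
  case True
  with Q show ?thesis by simp
next
  case T: False
  define d where "d = natural_dist P 1 b \<psi> \<xi>"
  define e where "e k = D / 2 ^ (k + 1)" for k :: nat
  define h where "h \<epsilon> = exp_ereal (v_star 1 b \<psi> (2 + ln_ereal (ereal_of_enat (covering_number T d \<epsilon>))))" for \<epsilon>
  have e_pos: "e k > 0" for k
    using D by (simp add: e_def)
  have e_less: "e k < D" for k
  proof -
    have "D / 2 ^ (k + 1) < D / 1"
      using D by (intro divide_strict_left_mono) (auto intro: one_less_power simp del: power_Suc)
    then show ?thesis by (simp add: e_def)
  qed
  have b: "1 < b" and pos: "\<And>p. p \<in> einterval 1 b \<Longrightarrow> \<psi> p > 0"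
    using psi by (auto simp: psi_function_def)
  obtain p where p: "p \<in> einterval 1 b"
    using einterval_nonempty[OF b] by blast
  then have p1: "p \<ge> 1" by (simp add: einterval_def)

  have "\<exists>F. finite F \<and> F \<subseteq> T \<and> (\<forall>y\<in>T. \<exists>x\<in>F. d x y \<le> ennreal (e k)) \<and>
      covering_number T d (e k) = enat (card F)" for k
    using covering_number_attained[OF covering_number_finite[OF I e_pos e_less]]
    unfolding d_def by metis
  then obtain F where F: "\<And>k. finite (F k)" "\<And>k. F k \<subseteq> T"
      "\<And>k y. y \<in> T \<Longrightarrow> \<exists>x\<in>F k. d x y \<le> ennreal (e k)"
      "\<And>k. covering_number T d (e k) = enat (card (F k))"
    by metis
  define \<pi> where "\<pi> k y = (SOME x. x \<in> F k \<and> d x y \<le> ennreal (e k))" for k y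
  have "\<pi> k y \<in> F k \<and> d (\<pi> k y) y \<le> ennreal (e k)" if "y \<in> T" for k y
    unfolding \<pi>_def by (rule someI_ex) (use F(3)[OF that] in blast)
  then have \<pi>: "\<And>k y. y \<in> T \<Longrightarrow> \<pi> k y \<in> F k" "\<And>k y. y \<in> T \<Longrightarrow> d (\<pi> k y) y \<le> ennreal (e k)"
    by auto
  have FT: "t \<in> T" if "t \<in> F k" for t k
    using that F(2) by blast
  have ne: "F k \<noteq> {}" for k
    using T F(3) by blast
  have \<pi>T: "\<pi> k y \<in> T" if "y \<in> T" for k y
    using \<pi>(1)[OF that] F(2) by blast
  have incr: "gpsi_norm P 1 b \<psi> (\<lambda>\<omega>. \<xi> y \<omega> - \<xi> (\<pi> k y) \<omega>) \<le> ennreal (e k)" if "y \<in> T" for k y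
    using \<pi>(2)[OF that, of k]
    by (simp add: d_def natural_dist_def gpsi_norm_def moment_norm_def norm_minus_commute)
  have [measurable]: "\<xi> y \<in> borel_measurable P" "\<xi> (\<pi> k y) \<in> borel_measurable P" if "y \<in> T" for k y
    using that \<pi>T meas by auto

  define m where "m \<omega> = (SUP t\<in>F 0. ennreal (norm (\<xi> t \<omega>)))" for \<omega>
  define Y where "Y k \<omega> = (SUP t\<in>F (Suc k). ennreal (norm (\<xi> t \<omega> - \<xi> (\<pi> k t) \<omega>)))" for k \<omega>
  have [measurable]: "m \<in> borel_measurable P"
    unfolding m_def
  proof (intro borel_measurable_SUP)
    fix t assume "t \<in> F 0"
    then have "t \<in> T" by (rule FT)
    then show "(\<lambda>\<omega>. ennreal (norm (\<xi> t \<omega>))) \<in> borel_measurable P"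
      by measurable
  qed (use F(1) in \<open>auto intro: countable_finite\<close>)
  have [measurable]: "Y k \<in> borel_measurable P" for k
    unfolding Y_def
  proof (intro borel_measurable_SUP)
    fix t assume "t \<in> F (Suc k)"
    then have "t \<in> T" by (rule FT)
    then show "(\<lambda>\<omega>. ennreal (norm (\<xi> t \<omega> - \<xi> (\<pi> k t) \<omega>))) \<in> borel_measurable P"
      by measurable
  qed (use F(1) in \<open>auto intro: countable_finite\<close>)

  have "(\<integral>\<^sup>+\<omega>. m \<omega> \<partial>P) \<le> ennreal (2 * (real (card (F 0)) powr (1 / p) * (1 * \<psi> p)))"
    unfolding m_def using F(1) ne p1 pos[OF p] unit[OF FT] meas[OF FT]
    by (intro nn_integral_SUP_le_moments[OF P] moment_norm_le_gpsi_norm[where \<psi> = \<psi>, OF p pos[OF p]]) auto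
  then have m_fin: "(\<integral>\<^sup>+\<omega>. m \<omega> \<partial>P) \<noteq> \<infinity>"
    by (auto simp: top_unique)
  have Y_le: "(\<integral>\<^sup>+\<omega>. Y k \<omega> \<partial>P) \<le> 2 * (ennreal (D / 2 ^ (k + 1)) * h (D / 2 ^ (k + 2)))" for k
  proof -
    have "(\<integral>\<^sup>+\<omega>. Y k \<omega> \<partial>P) \<le> ennreal (2 * e k) * h (e (Suc k))"
      unfolding Y_def h_def F(4)
    proof (rule nn_integral_SUP_le_exp_v_star[OF P psi e_pos F(1) ne])
      fix t assume "t \<in> F (Suc k)"
      then have "t \<in> T" by (rule FT)
      then show "(\<lambda>\<omega>. \<xi> t \<omega> - \<xi> (\<pi> k t) \<omega>) \<in> borel_measurable P"
        by measurable
      show "gpsi_norm P 1 b \<psi> (\<lambda>\<omega>. \<xi> t \<omega> - \<xi> (\<pi> k t) \<omega>) \<le> ennreal (e k)"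
        by (rule incr) fact
    qed
    also have "ennreal (2 * e k) = 2 * ennreal (e k)"
      using e_pos[of k] by (subst ennreal_mult) auto
    finally show ?thesis
      by (simp add: e_def mult.assoc)
  qed
  have h_anti: "\<And>\<epsilon> \<epsilon>'. \<epsilon> \<le> \<epsilon>' \<Longrightarrow> h \<epsilon>' \<le> h \<epsilon>"
    unfolding h_def by (rule entropy_integrand_antimono)
  have "(\<integral>\<^sup>+\<omega>. (\<Sum>k. Y k \<omega>) \<partial>P) = (\<Sum>k. \<integral>\<^sup>+\<omega>. Y k \<omega> \<partial>P)"
    by (rule nn_integral_suminf) measurable
  also have "\<dots> \<le> (\<Sum>k. 2 * (ennreal (D / 2 ^ (k + 1)) * h (D / 2 ^ (k + 2))))"
    by (intro suminf_le Y_le) auto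
  also have "\<dots> = 2 * (\<Sum>k. ennreal (D / 2 ^ (k + 1)) * h (D / 2 ^ (k + 2)))"
    by simp
  also have "\<dots> \<le> 2 * (4 * (\<integral>\<^sup>+\<epsilon>\<in>{0<..<D}. h \<epsilon> \<partial>lborel))"
    by (intro mult_left_mono dyadic_sum_le_integral h_anti D) auto
  also have "\<dots> < \<infinity>"
    using I unfolding h_def d_def by (simp add: ennreal_mult_less_top)
  finally have Y_fin: "(\<integral>\<^sup>+\<omega>. (\<Sum>k. Y k \<omega>) \<partial>P) \<noteq> \<infinity>"
    by simp

  have approx: "AE \<omega> in P. (\<lambda>k. norm (\<xi> q \<omega> - \<xi> (\<pi> k q) \<omega>)) \<longlonglongrightarrow> 0" if "q \<in> Q" for q
  proof -
    have q: "q \<in> T" using that Q by blast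
    have le: "(\<integral>\<^sup>+\<omega>. ennreal (norm (\<xi> q \<omega> - \<xi> (\<pi> k q) \<omega>)) \<partial>P) \<le> ennreal (2 * (e k * \<psi> p))" for k
    proof -
      have "(\<integral>\<^sup>+\<omega>. (SUP t\<in>{q}. ennreal (norm (\<xi> t \<omega> - \<xi> (\<pi> k t) \<omega>))) \<partial>P)
          \<le> ennreal (2 * (real (card {q}) powr (1 / p) * (e k * \<psi> p)))"
        using p1 e_pos[of k] pos[OF p] q incr[OF q]
        by (intro nn_integral_SUP_le_moments[OF P] moment_norm_le_gpsi_norm[where \<psi> = \<psi>, OF p pos[OF p]]) auto
      then show ?thesis by simp
    qed
    have summ: "summable (\<lambda>k. 2 * (e k * \<psi> p))"
    proof -
      have "summable (\<lambda>k. (2 * D * \<psi> p) * (1 / 2) ^ (k + 1))"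
        by (intro summable_mult summable_ignore_initial_segment summable_geometric) auto
      then show ?thesis
        by (simp add: e_def power_divide mult_ac)
    qed
    have "(\<integral>\<^sup>+\<omega>. (\<Sum>k. ennreal (norm (\<xi> q \<omega> - \<xi> (\<pi> k q) \<omega>))) \<partial>P)
        = (\<Sum>k. \<integral>\<^sup>+\<omega>. ennreal (norm (\<xi> q \<omega> - \<xi> (\<pi> k q) \<omega>)) \<partial>P)"
      using q by (intro nn_integral_suminf) measurable
    also have "\<dots> \<le> (\<Sum>k. ennreal (2 * (e k * \<psi> p)))"
      by (intro suminf_le le) auto
    also have "\<dots> = ennreal (\<Sum>k. 2 * (e k * \<psi> p))"
      using summ e_pos pos[OF p] by (intro suminf_ennreal2) (auto simp: less_imp_le)
    finally have "(\<integral>\<^sup>+\<omega>. (\<Sum>k. ennreal (norm (\<xi> q \<omega> - \<xi> (\<pi> k q) \<omega>))) \<partial>P) \<noteq> \<infinity>"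
      by (auto simp: top_unique)
    then have "AE \<omega> in P. (\<Sum>k. ennreal (norm (\<xi> q \<omega> - \<xi> (\<pi> k q) \<omega>))) \<noteq> \<infinity>"
      using q by (intro nn_integral_PInf_AE) measurable
    then show ?thesis
    proof eventually_elim
      case (elim \<omega>)
      then have "summable (\<lambda>k. norm (\<xi> q \<omega> - \<xi> (\<pi> k q) \<omega>))"
        by (intro summable_suminf_not_top) auto
      then show ?case by (rule summable_LIMSEQ_zero)
    qed
  qed
  have "AE \<omega> in P. \<forall>q\<in>Q. (\<lambda>k. norm (\<xi> q \<omega> - \<xi> (\<pi> k q) \<omega>)) \<longlonglongrightarrow> 0"
    using approx by (simp add: AE_ball_countable Q(1))
  moreover have "AE \<omega> in P. m \<omega> \<noteq> \<infinity>"
    using m_fin by (intro nn_integral_PInf_AE) auto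
  moreover have "AE \<omega> in P. (\<Sum>k. Y k \<omega>) \<noteq> \<infinity>"
    using Y_fin by (intro nn_integral_PInf_AE) auto
  ultimately show ?thesis
  proof eventually_elim
    case (elim \<omega>)
    define R where "R = enn2real (m \<omega> + (\<Sum>k. Y k \<omega>))"
    have R: "ennreal R = m \<omega> + (\<Sum>k. Y k \<omega>)"
      using elim by (simp add: R_def less_top)
    have net: "norm (\<xi> t \<omega>) \<le> R" if "t \<in> F k" for t k
    proof -
      have "\<pi> j s \<in> F j" if "s \<in> F (Suc j)" for j s
        by (intro \<pi>(1) FT[OF that])
      from chain_bound[where F = F and \<pi> = \<pi> and x = "\<lambda>t. \<xi> t \<omega>", OF this that]
      have "ennreal (norm (\<xi> t \<omega>)) \<le> m \<omega> + (\<Sum>j. Y j \<omega>)"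
        unfolding m_def Y_def .
      moreover have "R \<ge> 0"
        by (simp add: R_def)
      ultimately show ?thesis
        unfolding R[symmetric] by (simp only: ennreal_le_iff)
    qed
    have "norm (\<xi> q \<omega>) \<le> R" if q: "q \<in> Q" for q
    proof (rule LIMSEQ_le_const)
      show "(\<lambda>k. R + norm (\<xi> q \<omega> - \<xi> (\<pi> k q) \<omega>)) \<longlonglongrightarrow> R"
        using tendsto_add[OF tendsto_const[of R] elim(1)[rule_format, OF q]] by simp
      have "norm (\<xi> q \<omega>) \<le> R + norm (\<xi> q \<omega> - \<xi> (\<pi> k q) \<omega>)" for k
        using norm_triangle_ineq[of "\<xi> (\<pi> k q) \<omega>" "\<xi> q \<omega> - \<xi> (\<pi> k q) \<omega>"]
          net[OF \<pi>(1), of q k] q Q(2) by auto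
      then show "\<exists>N. \<forall>n\<ge>N. norm (\<xi> q \<omega>) \<le> R + norm (\<xi> q \<omega> - \<xi> (\<pi> n q) \<omega>)"
        by blast
    qed
    then show ?case by blast
  qed
qed

text \<open>Separability is applied to the open set \<open>T\<close> and to the closed ball of radius \<open>R\<close>.\<close>

lemma AE_bounded:
  fixes \<xi> :: "'t \<Rightarrow> 'w \<Rightarrow> 'k::{real_normed_vector, second_countable_topology}"
  assumes P: "prob_space P" and psi: "psi_function 1 b \<psi>"
    and sep: "separable_field T (natural_dist P 1 b \<psi> \<xi>) P \<xi>"
    and meas: "\<And>t. t \<in> T \<Longrightarrow> \<xi> t \<in> borel_measurable P"
    and unit: "\<And>t. t \<in> T \<Longrightarrow> gpsi_norm P 1 b \<psi> (\<xi> t) \<le> 1"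
    and D: "D > 0"
    and I: "(\<integral>\<^sup>+\<epsilon>\<in>{0<..<D}. exp_ereal (v_star 1 b \<psi>
      (2 + ln_ereal (ereal_of_enat (covering_number T (natural_dist P 1 b \<psi> \<xi>) \<epsilon>)))) \<partial>lborel) < \<infinity>"
  shows "AE \<omega> in P. \<exists>R. \<forall>t\<in>T. norm (\<xi> t \<omega>) \<le> R"
proof -
  let ?d = "natural_dist P 1 b \<psi> \<xi>"
  obtain Q where Q: "countable Q" "Q \<subseteq> T"
    and AE_Q: "AE \<omega> in P. \<forall>G F. dist_open T ?d G \<and> closed F \<and> (\<forall>t\<in>G \<inter> Q. \<xi> t \<omega> \<in> F) \<longrightarrow>
      (\<forall>t\<in>G. \<xi> t \<omega> \<in> F)"
    using sep unfolding separable_field_def by blast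
  have "dist_open T ?d T"
    by (auto simp: dist_open_def intro: exI[of _ 1])
  have "AE \<omega> in P. \<exists>R. \<forall>q\<in>Q. norm (\<xi> q \<omega>) \<le> R"
    by (rule AE_bounded_on_countable[OF P psi meas unit D I Q])
  with AE_Q show ?thesis
  proof eventually_elim
    case (elim \<omega>)
    then obtain R where "\<forall>q\<in>Q. norm (\<xi> q \<omega>) \<le> R"
      by blast
    then have "\<forall>t\<in>T. \<xi> t \<omega> \<in> cball 0 R"
      using elim(1)[rule_format, of T "cball 0 R"] \<open>dist_open T ?d T\<close> by simp
    then show ?case by auto
  qed
qed

section \<open>Bounded functions and the norming set\<close>

lemma real_part_le_norm: "real_part z \<le> norm z"
  using norm_cauchy_schwarz[of z 1] by (simp add: real_part_def)

lemma pairing_le_L1: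
  assumes int: "integrable M (\<lambda>t. f t * g t)" and g: "g \<in> borel_measurable M"
    and f: "\<And>t. t \<in> space M \<Longrightarrow> norm (f t) \<le> R" and R: "R \<ge> 0"
    and L1: "L1_norm M g \<le> ennreal C"
  shows "real_part (pairing M g f) \<le> R * max 0 C"
proof -
  have "ennreal (norm (pairing M g f)) \<le> (\<integral>\<^sup>+t. ennreal (norm (f t * g t)) \<partial>M)"
    unfolding pairing_def by (rule integral_norm_bound_ennreal[OF int])
  also have "\<dots> \<le> (\<integral>\<^sup>+t. ennreal R * ennreal (norm (g t)) \<partial>M)"
    using f R by (intro nn_integral_mono)
      (auto simp: norm_mult ennreal_mult[symmetric] intro!: ennreal_leI mult_right_mono)
  also have "\<dots> = ennreal R * L1_norm M g"
    using g unfolding L1_norm_def by (intro nn_integral_cmult) auto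
  also have "\<dots> \<le> ennreal R * ennreal (max 0 C)"
    using L1 by (intro mult_left_mono) (auto simp: max_def ennreal_neg)
  also have "\<dots> = ennreal (R * max 0 C)"
    using R by (simp add: ennreal_mult)
  finally have "norm (pairing M g f) \<le> R * max 0 C"
    using R by (simp add: ennreal_le_iff)
  with real_part_le_norm[of "pairing M g f"] show ?thesis
    by linarith
qed

context banach_function_norm
begin

text \<open>
  The norming property speaks only about functions already known to lie in \<open>L\<close>. It is therefore
  applied to the restrictions of \<open>f\<close> to an exhaustion by sets of finite measure, which lie in \<open>L\<close>
  because they are dominated by multiples of indicators; the resulting bound is uniform.
\<close>

lemma bfs_if_bounded:
  fixes f :: "'t \<Rightarrow> 'k::{real_normed_field, euclidean_space}" and S :: "('t \<Rightarrow> 'k) set"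
  assumes f: "f \<in> borel_measurable M" and bound: "\<And>t. t \<in> space M \<Longrightarrow> norm (f t) \<le> R"
    and S: "S \<subseteq> associate_space M \<rho>"
    and norming: "\<And>f. f \<in> bfs M \<rho> \<Longrightarrow>
      ereal (bfs_norm \<rho> f) \<le> (SUP g\<in>S. ereal (real_part (pairing M g f)))"
    and L1: "\<And>g. g \<in> S \<Longrightarrow> L1_norm M g \<le> ennreal C"
  shows "f \<in> bfs M \<rho>"
proof -
  define R' where "R' = max 0 R"
  have R': "R' \<ge> 0"
    by (simp add: R'_def)
  have bound': "norm (f t) \<le> R'" if "t \<in> space M" for t
    using bound[OF that] by (simp add: R'_def)
  obtain A where A: "range A \<subseteq> sets M" "(\<Union>i. A i) = space M" "\<And>i. emeasure M (A i) \<noteq> \<infinity>" "incseq A"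
    using sigma_finite_incseq by blast
  have [measurable]: "A n \<in> sets M" for n
    using A(1) by blast
  define fn where "fn n t = indicator (A n) t *\<^sub>R f t" for n t
  have [measurable]: "fn n \<in> borel_measurable M" "f \<in> borel_measurable M" for n
    using f unfolding fn_def by auto
  have fn_le: "norm (fn n t) \<le> R'" if "t \<in> space M" for n t
    using bound'[OF that] R' by (auto simp: fn_def indicator_def)
  have in_bfs: "fn n \<in> bfs M \<rho>" for n
  proof -
    have "\<rho> (\<lambda>t. ennreal (norm (fn n t))) \<le> \<rho> (\<lambda>t. ennreal (R') * indicator (A n) t)"
    proof (rule mono)
      show "AE t in M. ennreal (norm (fn n t)) \<le> ennreal (R') * indicator (A n) t"
        using bound' by (intro AE_I2) (auto simp: fn_def indicator_def intro!: ennreal_leI)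
    qed measurable
    also have "\<dots> = ennreal (R') * \<rho> (indicator (A n))"
      by (intro scale R') auto
    also have "\<dots> < \<infinity>"
      using finite_indicator[of "A n"] A(3)[of n] by (simp add: ennreal_mult_less_top less_top)
    finally show ?thesis
      by (simp add: bfs_def)
  qed
  have le: "\<rho> (\<lambda>t. ennreal (norm (fn n t))) \<le> ennreal (R' * max 0 C)" for n
  proof -
    have "ereal (bfs_norm \<rho> (fn n)) \<le> (SUP g\<in>S. ereal (real_part (pairing M g (fn n))))"
      by (rule norming[OF in_bfs])
    also have "\<dots> \<le> ereal (R' * max 0 C)"
    proof (rule SUP_least)
      fix g assume "g \<in> S"
      then have g: "g \<in> borel_measurable M" "integrable M (\<lambda>t. fn n t * g t)" "L1_norm M g \<le> ennreal C"
        using S in_bfs L1 by (auto simp: associate_space_def)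
      show "ereal (real_part (pairing M g (fn n))) \<le> ereal (R' * max 0 C)"
        using pairing_le_L1[OF g(2,1) fn_le R' g(3)] by simp
    qed
    finally have "enn2real (\<rho> (\<lambda>t. ennreal (norm (fn n t)))) \<le> R' * max 0 C"
      by (simp add: bfs_norm_def)
    then have "ennreal (enn2real (\<rho> (\<lambda>t. ennreal (norm (fn n t))))) \<le> ennreal (R' * max 0 C)"
      by (rule ennreal_leI)
    then show ?thesis
      using in_bfs[of n] by (simp add: bfs_def less_top)
  qed
  have "\<rho> (\<lambda>t. ennreal (norm (f t))) = (SUP n. \<rho> (\<lambda>t. ennreal (norm (fn n t))))"
  proof (rule fatou)
    show "AE t in M. incseq (\<lambda>n. ennreal (norm (fn n t))) \<and>
        ennreal (norm (f t)) = (SUP n. ennreal (norm (fn n t)))"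
    proof (intro AE_I2 conjI)
      fix t assume t: "t \<in> space M"
      show "incseq (\<lambda>n. ennreal (norm (fn n t)))"
        using incseq_SucD[OF A(4)]
        by (intro incseq_SucI) (auto simp: fn_def indicator_def)
      obtain n where n: "t \<in> A n"
        using t A(2) by blast
      show "ennreal (norm (f t)) = (SUP n. ennreal (norm (fn n t)))"
      proof (rule antisym)
        show "ennreal (norm (f t)) \<le> (SUP n. ennreal (norm (fn n t)))"
          using n by (intro SUP_upper2[of n]) (auto simp: fn_def)
        show "(SUP n. ennreal (norm (fn n t))) \<le> ennreal (norm (f t))"
          by (intro SUP_least) (auto simp: fn_def indicator_def)
      qed
    qed
  qed measurable
  also have "\<dots> \<le> ennreal (R' * max 0 C)"
    by (intro SUP_least le)
  also have "\<dots> < \<infinity>"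
    by simp
  finally show ?thesis
    using f by (simp add: bfs_def)
qed

text \<open>
  If one functional \<open>g\<^sub>0\<close> computes the norm, then \<open>\<parallel>f\<parallel>\<close> and \<open>\<parallel>-f\<parallel>\<close> are opposite numbers, so the
  norm vanishes on \<open>L\<close>, in particular on the indicators of the sets of finite measure.
\<close>

lemma null_measure_if_single_norming:
  fixes S :: "('t \<Rightarrow> 'k::{real_normed_field, euclidean_space}) set"
  assumes S: "S \<subseteq> associate_space M \<rho>"
    and norming: "\<And>f. f \<in> bfs M \<rho> \<Longrightarrow>
      ereal (bfs_norm \<rho> f) = (SUP g\<in>S. ereal (real_part (pairing M g f)))"
    and single: "\<And>g1 g2. g1 \<in> S \<Longrightarrow> g2 \<in> S \<Longrightarrow> L1_norm M (\<lambda>t. g1 t - g2 t) = 0"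
  shows "AE t in M. False"
proof -
  have zero_bfs: "(\<lambda>_. 0::'k) \<in> bfs M \<rho>"
    using eq_0_iff[of "\<lambda>_. 0"] by (simp add: bfs_def)
  have "S \<noteq> {}"
    using norming[OF zero_bfs] by (auto simp: bot_ereal_def)
  then obtain g0 where g0: "g0 \<in> S" by blast
  have meas: "g \<in> borel_measurable M" if "g \<in> S" for g
    using S that by (auto simp: associate_space_def)
  have norm_eq: "bfs_norm \<rho> f = real_part (pairing M g0 f)" if f: "f \<in> bfs M \<rho>" for f
  proof -
    have "pairing M g f = pairing M g0 f" if g: "g \<in> S" for g
    proof -
      have [measurable]: "g \<in> borel_measurable M" "g0 \<in> borel_measurable M" "f \<in> borel_measurable M"
        using g g0 meas f by (auto simp: bfs_def)
      have "AE t in M. ennreal (norm (g t - g0 t)) = 0"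
        using single[OF g g0] unfolding L1_norm_def by (subst (asm) nn_integral_0_iff_AE) auto
      then have "AE t in M. f t * g t = f t * g0 t"
        by eventually_elim simp
      then show ?thesis
        unfolding pairing_def by (intro integral_cong_AE) auto
    qed
    then have "(SUP g\<in>S. ereal (real_part (pairing M g f))) = (SUP g\<in>S. ereal (real_part (pairing M g0 f)))"
      by (intro SUP_cong) auto
    with norming[OF f] \<open>S \<noteq> {}\<close> show ?thesis
      by simp
  qed
  have vanish: "bfs_norm \<rho> f = 0" if f: "f \<in> bfs M \<rho>" for f :: "'t \<Rightarrow> 'k"
  proof -
    have "(\<lambda>t. - f t) \<in> bfs M \<rho>"
      using f by (auto simp: bfs_def)
    then have "bfs_norm \<rho> (\<lambda>t. - f t) = - bfs_norm \<rho> f"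
      by (simp add: norm_eq f pairing_def real_part_def)
    then show ?thesis
      by (simp add: bfs_norm_def)
  qed
  obtain A where A: "range A \<subseteq> sets M" "(\<Union>i. A i) = space M" "\<And>i. emeasure M (A i) \<noteq> \<infinity>" "incseq A"
    using sigma_finite_incseq by blast
  have [measurable]: "A n \<in> sets M" for n
    using A(1) by blast
  have null: "AE t in M. t \<notin> A n" for n
  proof -
    let ?f = "\<lambda>t. indicator (A n) t *\<^sub>R (1::'k)"
    have eq: "(\<lambda>t. ennreal (norm (?f t))) = indicator (A n)"
      by (auto simp: indicator_def)
    have fin: "\<rho> (indicator (A n)) < \<infinity>"
      using finite_indicator[of "A n"] A(3)[of n] by (simp add: less_top)
    then have "?f \<in> bfs M \<rho>"
      unfolding bfs_def mem_Collect_eq eq by auto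
    from vanish[OF this] have "enn2real (\<rho> (indicator (A n))) = 0"
      unfolding bfs_norm_def eq .
    then have "\<rho> (indicator (A n)) = 0"
      using fin by (auto simp: enn2real_eq_0_iff)
    then have "AE t in M. (indicator (A n) t :: ennreal) = 0"
      by (subst (asm) eq_0_iff) auto
    then show ?thesis
      by eventually_elim (auto simp: indicator_def split: if_splits)
  qed
  then have "AE t in M. \<forall>n. t \<notin> A n"
    by (simp add: AE_all_countable)
  with AE_space show ?thesis
    by eventually_elim (use A(2) in blast)
qed

end

section \<open>The field has paths in the function space\<close>

theorem theorem3p1:
  fixes M :: "'t measure" and P :: "'w measure"
    and \<rho> :: "('t \<Rightarrow> ennreal) \<Rightarrow> ennreal"
    and \<xi> :: "'t \<Rightarrow> 'w \<Rightarrow> 'k::{real_normed_field, euclidean_space}"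
    and \<psi> :: "real \<Rightarrow> real" and b :: ereal
    and S :: "('t \<Rightarrow> 'k) set" and d :: "'t \<Rightarrow> 't \<Rightarrow> ennreal"
    and C1 :: real and D :: ennreal
  assumes L: "ri_function_norm M \<rho>"
    and mu_separable: "separable_measure M"
    and P: "prob_space P"
    and psi: "psi_function 1 b \<psi>"
    and d: "d = natural_dist P 1 b \<psi> \<xi>"
    and xi_measurable: "(\<lambda>(t, \<omega>). \<xi> t \<omega>) \<in> borel_measurable (M \<Otimes>\<^sub>M P)"
    and xi_separable: "separable_field (space M) d P \<xi>"
    and natural: "\<forall>p\<in>einterval 1 b. natural_function (space M) P \<xi> p < \<infinity> \<and>
        natural_function (space M) P \<xi> p \<le> ennreal (\<psi> p)"
    and normalized: "(SUP t\<in>space M. gpsi_norm P 1 b \<psi> (\<xi> t)) = 1"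
    and S: "S = extremal_points M \<rho>"
    and S_norming: "\<forall>f\<in>bfs M \<rho>. ereal (bfs_norm \<rho> f) = (SUP g\<in>S. ereal (real_part (pairing M g f)))"
    and l_xi: "\<forall>g\<in>associate_space M \<rho>. AE \<omega> in P. integrable M (\<lambda>t. \<xi> t \<omega> * g t)"
    and S_L1: "\<forall>g\<in>S. L1_norm M g \<le> ennreal C1"
    and D: "D = (SUP g1\<in>S. SUP g2\<in>S. L1_norm M (\<lambda>t. g1 t - g2 t))" "D < \<infinity>"
    and I: "(\<integral>\<^sup>+\<epsilon>\<in>{0<..<enn2real D}.
        exp_ereal (v_star 1 b \<psi>
          (2 + ln_ereal (ereal_of_enat (covering_number (space M) d \<epsilon>)))) \<partial>lborel) < \<infinity>"
  shows "AE \<omega> in P. (\<lambda>t. \<xi> t \<omega>) \<in> bfs M \<rho>"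
proof -
  interpret ri_function_norm M \<rho> by (rule L)
  have S_assoc: "S \<subseteq> associate_space M \<rho>"
    by (auto simp: S extremal_points_def associate_ball_def)
  have path: "(\<lambda>t. \<xi> t \<omega>) \<in> borel_measurable M" if "\<omega> \<in> space P" for \<omega>
    using measurable_Pair1[OF xi_measurable that] by simp
  show ?thesis
  proof (cases "D = 0")
    case True
    have single: "L1_norm M (\<lambda>t. g1 t - g2 t) = 0" if "g1 \<in> S" "g2 \<in> S" for g1 g2
    proof -
      have "L1_norm M (\<lambda>t. g1 t - g2 t) \<le> D"
        unfolding D(1) using that by (intro SUP_upper2[of g1] SUP_upper2[of g2]) auto
      with True show ?thesis by simp
    qed
    have "AE t in M. False"
      using null_measure_if_single_norming[OF S_assoc _ single] S_norming by blast
    then have "\<rho> (\<lambda>t. ennreal (norm (\<xi> t \<omega>))) = 0" if "\<omega> \<in> space P" for \<omega>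
      using path[OF that] by (subst eq_0_iff) auto
    with path show ?thesis
      by (intro AE_I2) (auto simp: bfs_def)
  next
    case False
    then have D_pos: "enn2real D > 0"
      using D(2) by (simp add: enn2real_positive_iff zero_less_iff_neq_zero)
    have meas: "\<xi> t \<in> borel_measurable P" if "t \<in> space M" for t
      using measurable_Pair2[OF xi_measurable that] by simp
    have unit: "gpsi_norm P 1 b \<psi> (\<xi> t) \<le> 1" if "t \<in> space M" for t
      using SUP_upper[OF that, of "\<lambda>t. gpsi_norm P 1 b \<psi> (\<xi> t)"] normalized by simp
    have "AE \<omega> in P. \<exists>R. \<forall>t\<in>space M. norm (\<xi> t \<omega>) \<le> R"
      using xi_separable I unfolding d by (intro AE_bounded[OF P psi _ meas unit D_pos])
    with AE_space show ?thesis
    proof eventually_elim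
      case (elim \<omega>)
      then obtain R where "\<forall>t\<in>space M. norm (\<xi> t \<omega>) \<le> R"
        by blast
      then show ?case
        using S_norming S_L1
        by (intro bfs_if_bounded[OF path[OF elim(1)] _ S_assoc]) auto
    qed
  qed
qed

end
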